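(* Let $\mathcal{M}$ be a smooth manifold, let $\mathbf{G}$ be a Lie group, and let $\phi:\mathbf{G}\times\mathcal{M}\to\mathcal{M}$ be a smooth transitive right action. Let $\mathbb{V}$ be a real vector space and let $f:\mathbb{V}\to\mathfrak{X}(\mathcal{M})$, $v\mapsto f_v$, be a linear map with $\ker f=\{0\}$ (a kinematic system). Let $$\mathcal{V}:=\operatorname{span}\{\mathrm{d}_\star\phi_X f_v \;:\; X\in\mathbf{G},\ v\in\mathbb{V}\}\subset\mathfrak{X}(\mathcal{M})$$ be the extended velocity space (possibly infinite-dimensional), and let $\mathfrak{f}:\mathcal{V}\to\mathfrak{X}(\mathcal{M})$, $w\mapsto \mathfrak{f}_w$, be the extended kinematic system, namely the inclusion map, so that $\mathfrak{f}_w=w$ as a vector field. Define $$\psi(X,w):=\mathrm{d}_\star\phi_X\,\mathfrak{f}_w\qquad (X\in\mathbf{G},\ w\in\mathcal{V}),$$ that is, $\psi$ is the restriction of $\mathrm{d}_\star\phi$ to $\mathcal{V}$. Then $\psi$ is a well-defined right group action $\psi:\mathbf{G}\times\mathcal{V}\to\mathcal{V}$ (in particular $\psi(X,w)\in\mathcal{V}$ for all $X\in\mathbf{G}$, $w\in\mathcal{V}$), and the extended system $\mathfrak{f}$ is equivariant with respect to the actions $\psi$ and $\phi$, i.e. $$\mathrm{D}\phi_X(\xi)\big[\mathfrak{f}_w(\xi)\big]=\mathfrak{f}_{\psi(X,w)}\big(\phi_X(\xi)\big)\qquad\text{for all }X\in\mathbf{G},\ w\in\mathcal{V},\ \xi\in\mathcal{M}.$$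 (Here $\mathfrak{f}$ is just a name for the inclusion map, distinct from $f$.)
   Context: $\mathfrak{X}(\mathcal{M})$ is the real vector space of (smooth) vector fields on $\mathcal{M}$. A right action satisfies $\phi(\mathrm{id},\xi)=\xi$ and $\phi(Y,\phi(X,\xi))=\phi(XY,\xi)$ for all $X,Y\in\mathbf{G}$, $\xi\in\mathcal{M}$. For $X\in\mathbf{G}$, $\phi_X:\mathcal{M}\to\mathcal{M}$ is $\phi_X(\xi):=\phi(X,\xi)$, and $\mathrm{D}\phi_X(\xi)$ denotes its derivative at $\xi$. For $g\in\mathfrak{X}(\mathcal{M})$, the vector field $\mathrm{d}_\star\phi_X g=\mathrm{d}_\star\phi(X,g)\in\mathfrak{X}(\mathcal{M})$ is the pushforward $$(\mathrm{d}_\star\phi_X g)(\xi):=\mathrm{D}\phi_X(\phi_X^{-1}(\xi))\big[g(\phi_X^{-1}(\xi))\big].$$ A kinematic system, i.e. a linear map $g:W\to\mathfrak{X}(\mathcal{M})$, $w\mapsto g_w$, on a real vector space $W$, is called equivariant if there is a right group action $\psi:\mathbf{G}\times W\to W$ with $\mathrm{D}\phi_X(\xi)[g_w(\xi)]=g_{\psi(X,w)}(\phi_X(\xi))$ for all $w\in W$, $\xi\in\mathcal{M}$, $X\in\mathbf{G}$. Group actions on the vector spaces $\mathfrak{X}(\mathcal{M})$, $\mathcal{V}$ and $W$ are meant in the algebraic sense. *)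

theory Defs
  imports "HOL-Analysis.Analysis" "HOL-Algebra.Group" "HOL-Library.Function_Algebras"
begin

text \<open>Pointwise real vector space structure on functions; HOL-Library.Function_Algebras provides
  the additive part only. It makes linear, span and subspace available for vector fields.\<close>

instantiation "fun" :: (type, scaleR) scaleR
begin

definition scaleR_fun :: "real \<Rightarrow> ('a \<Rightarrow> 'b) \<Rightarrow> 'a \<Rightarrow> 'b"
  where "scaleR_fun a f = (\<lambda>x. a *\<^sub>R f x)"

instance ..

end

instance "fun" :: (type, real_vector) real_vector
  by standard (simp_all add: scaleR_fun_def plus_fun_def fun_eq_iff
      scaleR_add_right scaleR_add_left)


section \<open>Smooth functions on open subsets of a finite-dimensional space\<close>

text \<open>For open \<open>S\<close> in a finite-dimensional space this is the usual notion of class \<open>C\<^sup>k\<close>: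
  the derivative is of class \<open>C\<^sup>k\<close> as a map into the linear maps iff all its evaluations at
  fixed vectors \<open>v\<close> are.\<close>

primrec Ck_on :: "nat \<Rightarrow> 'a::real_normed_vector set \<Rightarrow> ('a \<Rightarrow> 'b::real_normed_vector) \<Rightarrow> bool" where
  "Ck_on 0 S f \<longleftrightarrow> continuous_on S f"
| "Ck_on (Suc k) S f \<longleftrightarrow>
    (\<forall>x\<in>S. f differentiable (at x)) \<and>
    (\<forall>v. Ck_on k S (\<lambda>x. frechet_derivative f (at x) v))"

definition smooth_on :: "'a::real_normed_vector set \<Rightarrow> ('a \<Rightarrow> 'b::real_normed_vector) \<Rightarrow> bool"
  where "smooth_on S f \<longleftrightarrow> (\<forall>k. Ck_on k S f)"


section \<open>Smooth manifolds\<close>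

text \<open>A manifold is given by a topology, whose topspace is the underlying set, and an atlas.
  The second component of a chart \<open>(U, c)\<close> is only relevant on \<open>U\<close>.\<close>

record ('a, 'e) manifold =
  mtop :: "'a topology"
  atlas :: "('a set \<times> ('a \<Rightarrow> 'e)) set"

abbreviation points :: "('a, 'e, 'z) manifold_scheme \<Rightarrow> 'a set"
  where "points M \<equiv> topspace (mtop M)"

definition chart_of :: "'a topology \<Rightarrow> 'a set \<times> ('a \<Rightarrow> 'e::real_inner) \<Rightarrow> bool" where
  "chart_of T = (\<lambda>(U, c). openin T U \<and> open (c ` U) \<and>
     homeomorphic_map (subtopology T U) (top_of_set (c ` U)) c)"

definition smoothly_compatible ::
    "'a set \<times> ('a \<Rightarrow> 'e::real_inner) \<Rightarrow> 'a set \<times> ('a \<Rightarrow> 'e) \<Rightarrow> bool" where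
  "smoothly_compatible = (\<lambda>(U, c) (V, d). smooth_on (c ` (U \<inter> V)) (d \<circ> inv_into U c))"

text \<open>Hausdorff, second countable, without boundary. The model space is an arbitrary
  finite-dimensional inner product space; the class \<open>euclidean_space\<close> would exclude dimension 0
  (and thereby discrete Lie groups). The atlas need not be maximal, since any atlas determines
  the smooth structure.\<close>

definition smooth_manifold :: "('a, 'e::real_inner) manifold \<Rightarrow> bool" where
  "smooth_manifold M \<longleftrightarrow>
     (\<exists>B :: 'e set. finite B \<and> span B = UNIV) \<and>
     Hausdorff_space (mtop M) \<and> second_countable (mtop M) \<and>
     (\<forall>C\<in>atlas M. chart_of (mtop M) C) \<and>
     (\<Union>(U, c)\<in>atlas M. U) = points M \<and>
     (\<forall>C\<in>atlas M. \<forall>D\<in>atlas M. smoothly_compatible C D)"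

definition smooth_map ::
    "('a, 'e::real_inner) manifold \<Rightarrow> ('b, 'f::real_inner) manifold \<Rightarrow> ('a \<Rightarrow> 'b) \<Rightarrow> bool" where
  "smooth_map M N F \<longleftrightarrow>
     continuous_map (mtop M) (mtop N) F \<and>
     (\<forall>(U, c)\<in>atlas M. \<forall>(V, d)\<in>atlas N.
        smooth_on (c ` (U \<inter> F -` V)) (d \<circ> F \<circ> inv_into U c))"

definition product_manifold ::
    "('a, 'e) manifold \<Rightarrow> ('b, 'f) manifold \<Rightarrow> ('a \<times> 'b, 'e \<times> 'f) manifold" where
  "product_manifold M N =
     \<lparr>mtop = prod_topology (mtop M) (mtop N),
      atlas = {(U \<times> V, map_prod c d) | U c V d. (U, c) \<in> atlas M \<and> (V, d) \<in> atlas N}\<rparr>"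


section \<open>Tangent vectors and vector fields\<close>

text \<open>Real-valued smooth functions, normalised to be 0 off the underlying set so that each of
  them is represented exactly once.\<close>

definition smooth_functions :: "('a, 'e::real_inner) manifold \<Rightarrow> ('a \<Rightarrow> real) set" where
  "smooth_functions M =
     {h. (\<forall>(U, c)\<in>atlas M. smooth_on (c ` U) (h \<circ> inv_into U c)) \<and> (\<forall>x. x \<notin> points M \<longrightarrow> h x = 0)}"

type_synonym 'a tangent = "('a \<Rightarrow> real) \<Rightarrow> real"

text \<open>Tangent vectors at \<open>p\<close> are the derivations at \<open>p\<close> of the algebra of smooth functions,
  again normalised to be 0 off that algebra.\<close>

definition tangent_space :: "('a, 'e::real_inner) manifold \<Rightarrow> 'a \<Rightarrow> 'a tangent set" where
  "tangent_space M p =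
     {v. (\<forall>h\<in>smooth_functions M. \<forall>k\<in>smooth_functions M. v (\<lambda>x. h x + k x) = v h + v k) \<and>
         (\<forall>a. \<forall>h\<in>smooth_functions M. v (\<lambda>x. a * h x) = a * v h) \<and>
         (\<forall>h\<in>smooth_functions M. \<forall>k\<in>smooth_functions M.
            v (\<lambda>x. h x * k x) = h p * v k + k p * v h) \<and>
         (\<forall>h. h \<notin> smooth_functions M \<longrightarrow> v h = 0)}"

text \<open>\<open>differential M N F p\<close> is \<open>D F(p)\<close>, mapping the tangent space of \<open>M\<close> at \<open>p\<close> to that of \<open>N\<close>
  at \<open>F p\<close>. On derivations its formula \<open>v \<mapsto> (h \<mapsto> v (h \<circ> F))\<close> does not mention \<open>p\<close>.\<close>

definition differential ::
    "('a, 'e::real_inner) manifold \<Rightarrow> ('b, 'f::real_inner) manifold \<Rightarrow> ('a \<Rightarrow> 'b) \<Rightarrow> 'a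
      \<Rightarrow> 'a tangent \<Rightarrow> 'b tangent" where
  "differential M N F p v =
     (\<lambda>h. if h \<in> smooth_functions N then v (\<lambda>x. if x \<in> points M then h (F x) else 0) else 0)"

text \<open>The smooth vector fields, extended by 0 off the underlying set. This is a set of functions
  with pointwise vector space operations.\<close>

definition vector_fields :: "('a, 'e::real_inner) manifold \<Rightarrow> ('a \<Rightarrow> 'a tangent) set" where
  "vector_fields M =
     {g. (\<forall>p\<in>points M. g p \<in> tangent_space M p) \<and>
         (\<forall>h\<in>smooth_functions M. (\<lambda>p. g p h) \<in> smooth_functions M) \<and>
         (\<forall>p. p \<notin> points M \<longrightarrow> g p = 0)}"

definition pushforward ::
    "('a, 'e::real_inner) manifold \<Rightarrow> ('a \<Rightarrow> 'a) \<Rightarrow> ('a \<Rightarrow> 'a tangent) \<Rightarrow> 'a \<Rightarrow> 'a tangent" where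
  "pushforward M F g =
     (\<lambda>\<xi>. if \<xi> \<in> points M
          then differential M M F (inv_into (points M) F \<xi>) (g (inv_into (points M) F \<xi>))
          else 0)"


section \<open>Lie groups and right actions\<close>

definition lie_group :: "'g monoid \<Rightarrow> ('g, 'e::real_inner) manifold \<Rightarrow> bool" where
  "lie_group G L \<longleftrightarrow>
     group G \<and> smooth_manifold L \<and> points L = carrier G \<and>
     smooth_map (product_manifold L L) L (\<lambda>(X, Y). X \<otimes>\<^bsub>G\<^esub> Y) \<and>
     smooth_map L L (m_inv G)"

definition right_action :: "'g monoid \<Rightarrow> 's set \<Rightarrow> ('g \<Rightarrow> 's \<Rightarrow> 's) \<Rightarrow> bool" where
  "right_action G S \<alpha> \<longleftrightarrow>
     (\<forall>X\<in>carrier G. \<forall>s\<in>S. \<alpha> X s \<in> S) \<and>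
     (\<forall>s\<in>S. \<alpha> \<one>\<^bsub>G\<^esub> s = s) \<and>
     (\<forall>X\<in>carrier G. \<forall>Y\<in>carrier G. \<forall>s\<in>S. \<alpha> Y (\<alpha> X s) = \<alpha> (X \<otimes>\<^bsub>G\<^esub> Y) s)"

definition smooth_transitive_right_action ::
    "'g monoid \<Rightarrow> ('g, 'e::real_inner) manifold \<Rightarrow> ('m, 'f::real_inner) manifold
      \<Rightarrow> ('g \<Rightarrow> 'm \<Rightarrow> 'm) \<Rightarrow> bool" where
  "smooth_transitive_right_action G L M \<phi> \<longleftrightarrow>
     right_action G (points M) \<phi> \<and>
     smooth_map (product_manifold L M) M (\<lambda>(X, \<xi>). \<phi> X \<xi>) \<and>
     (\<forall>\<xi>\<in>points M. \<forall>\<eta>\<in>points M. \<exists>X\<in>carrier G. \<phi> X \<xi> = \<eta>)"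


section \<open>Kinematic systems\<close>

definition kinematic_system ::
    "('m, 'e::real_inner) manifold \<Rightarrow> 'w::real_vector set \<Rightarrow> ('w \<Rightarrow> 'm \<Rightarrow> 'm tangent) \<Rightarrow> bool" where
  "kinematic_system M W g \<longleftrightarrow>
     subspace W \<and> (\<forall>w\<in>W. g w \<in> vector_fields M) \<and>
     (\<forall>u\<in>W. \<forall>w\<in>W. g (u + w) = g u + g w) \<and>
     (\<forall>a. \<forall>w\<in>W. g (a *\<^sub>R w) = a *\<^sub>R g w)"

definition equivariant_wrt ::
    "'g monoid \<Rightarrow> ('m, 'e::real_inner) manifold \<Rightarrow> ('g \<Rightarrow> 'm \<Rightarrow> 'm) \<Rightarrow> 'w set
      \<Rightarrow> ('w \<Rightarrow> 'm \<Rightarrow> 'm tangent) \<Rightarrow> ('g \<Rightarrow> 'w \<Rightarrow> 'w) \<Rightarrow> bool" where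
  "equivariant_wrt G M \<phi> W g \<psi> \<longleftrightarrow>
     (\<forall>X\<in>carrier G. \<forall>w\<in>W. \<forall>\<xi>\<in>points M.
        differential M M (\<phi> X) \<xi> (g w \<xi>) = g (\<psi> X w) (\<phi> X \<xi>))"

definition extended_velocity_space ::
    "'g monoid \<Rightarrow> ('m, 'e::real_inner) manifold \<Rightarrow> ('g \<Rightarrow> 'm \<Rightarrow> 'm) \<Rightarrow> ('v \<Rightarrow> 'm \<Rightarrow> 'm tangent)
      \<Rightarrow> ('m \<Rightarrow> 'm tangent) set" where
  "extended_velocity_space G M \<phi> f = span {pushforward M (\<phi> X) (f v) | X v. X \<in> carrier G}"

text \<open>The inclusion map of the extended velocity space into the vector fields.\<close>

definition extended_system :: "('m \<Rightarrow> 'm tangent) \<Rightarrow> 'm \<Rightarrow> 'm tangent"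
  where "extended_system w = w"

definition extended_action ::
    "('m, 'e::real_inner) manifold \<Rightarrow> ('g \<Rightarrow> 'm \<Rightarrow> 'm) \<Rightarrow> 'g
      \<Rightarrow> ('m \<Rightarrow> 'm tangent) \<Rightarrow> 'm \<Rightarrow> 'm tangent" where
  "extended_action M \<phi> X w = pushforward M (\<phi> X) (extended_system w)"

end

theory Submission
  imports Defs
begin

text \<open>The pushforward is linear in the vector field and functorial in the diffeomorphism, hence
  \<open>d\<^sub>\<star>\<phi>\<close> is a linear right action which permutes the spanning set of the extended velocity
  space, and equivariance holds by the very definition of the pushforward. The work lies in
  showing that \<open>\<phi>\<^sub>X\<close> pulls smooth functions back to smooth functions, so that pushforwards of
  vector fields are again vector fields.\<close>

section \<open>Calculus of smooth functions\<close>

lemma Ck_on_subset: "Ck_on k S f \<Longrightarrow> T \<subseteq> S \<Longrightarrow> Ck_on k T f"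
  by (induction k arbitrary: f) (auto intro: continuous_on_subset)

text \<open>On an open set the derivative depends only on nearby values, so \<open>f\<close> and
  \<open>g\<close> have the same \<open>frechet_derivative\<close> there. The induction must vary
  both functions, since it continues with their directional derivatives.\<close>

lemma Ck_on_cong:
  assumes "open S" "\<And>x. x \<in> S \<Longrightarrow> f x = g x" "Ck_on k S f"
  shows "Ck_on k S g"
  using assms(2,3)
proof (induction k arbitrary: f g)
  case 0
  then show ?case by (auto simp: cong: continuous_on_cong)
next
  case (Suc k)
  have D: "(g has_derivative frechet_derivative f (at x)) (at x)" if "x \<in> S" for x
    using has_derivative_transform_within_open[OF _ \<open>open S\<close> that Suc.prems(1)]
      Suc.prems(2) that by (auto simp: frechet_derivative_works)
  have eq: "frechet_derivative f (at x) = frechet_derivative g (at x)" if "x \<in> S" for x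
    using D[OF that] by (rule frechet_derivative_at)
  have "Ck_on k S (\<lambda>x. frechet_derivative g (at x) v)" for v
  proof (rule Suc.IH)
    show "Ck_on k S (\<lambda>x. frechet_derivative f (at x) v)"
      using Suc.prems(2) by simp
  qed (simp add: eq)
  then show ?case
    using D by (auto simp: differentiable_def)
qed

text \<open>By uniqueness of the derivative, any explicit formula \<open>f'\<close> may replace the
  chosen \<open>frechet_derivative\<close>. The calculus rules below are inductions through this
  rule.\<close>

lemma Ck_on_SucI:
  assumes "open S" "\<And>x. x \<in> S \<Longrightarrow> (f has_derivative f' x) (at x)"
    "\<And>v. Ck_on k S (\<lambda>x. f' x v)"
  shows "Ck_on (Suc k) S f"
proof -
  have "f' x = frechet_derivative f (at x)" if "x \<in> S" for x
    using assms(2)[OF that] by (rule frechet_derivative_at)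
  then have "Ck_on k S (\<lambda>x. frechet_derivative f (at x) v)" for v
    by (intro Ck_on_cong[OF \<open>open S\<close> _ assms(3)[of v]]) auto
  then show ?thesis
    using assms(2) by (auto simp: differentiable_def)
qed

lemma Ck_on_Suc_has_derivative:
  "Ck_on (Suc k) S f \<Longrightarrow> x \<in> S \<Longrightarrow> (f has_derivative frechet_derivative f (at x)) (at x)"
  by (simp add: frechet_derivative_works)

lemma Ck_on_SucD: "Ck_on (Suc k) S f \<Longrightarrow> Ck_on k S f"
proof (induction k arbitrary: f)
  case 0
  then show ?case
    by (auto intro!: differentiable_imp_continuous_on differentiable_at_imp_differentiable_on)
next
  case (Suc k)
  then show ?case by (metis Ck_on.simps(2))
qed

text \<open>Differentiability is taken \<open>at x\<close>, not within \<open>S\<close>, so it is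
  decided on any open neighbourhood of \<open>x\<close>. This allows charts to be chosen point by
  point.\<close>

lemma Ck_on_local:
  assumes "\<And>x. x \<in> S \<Longrightarrow> \<exists>T. open T \<and> x \<in> T \<and> Ck_on k T f"
  shows "Ck_on k S f"
  using assms
proof (induction k arbitrary: f)
  case 0
  then have "\<forall>x\<in>S. isCont f x"
    by (metis Ck_on.simps(1) continuous_on_eq_continuous_at)
  then show ?case
    by (simp add: continuous_at_imp_continuous_on)
next
  case (Suc k)
  then show ?case
    by (simp; meson)
qed

section \<open>Closure of the class C^k under algebraic operations, composition and slicing\<close>

lemma Ck_on_const: "open S \<Longrightarrow> Ck_on k S (\<lambda>x. c)"
proof (induction k arbitrary: c)
  case (Suc k)
  then show ?case by (intro Ck_on_SucI[where f' = "\<lambda>x v. 0"]) auto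
qed auto

lemma Ck_on_add:
  "open S \<Longrightarrow> Ck_on k S f \<Longrightarrow> Ck_on k S g \<Longrightarrow> Ck_on k S (\<lambda>x. f x + g x)"
proof (induction k arbitrary: f g)
  case (Suc k)
  show ?case
    by (rule Ck_on_SucI[OF \<open>open S\<close> has_derivative_add]; (rule Ck_on_Suc_has_derivative)?)
      (use Suc in auto)
qed (auto intro: continuous_on_add)

lemma Ck_on_sum:
  assumes "open S" "\<And>i. i \<in> I \<Longrightarrow> Ck_on k S (f i)"
  shows "Ck_on k S (\<lambda>x. \<Sum>i\<in>I. f i x)"
  using assms(2)
  by (induction I rule: infinite_finite_induct) (auto intro!: Ck_on_const Ck_on_add assms(1))

lemma (in bounded_linear) Ck_on_bounded_linear:
  "open S \<Longrightarrow> Ck_on k S g \<Longrightarrow> Ck_on k S (\<lambda>x. f (g x))"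
proof (induction k arbitrary: g)
  case (Suc k)
  show ?case
    by (rule Ck_on_SucI[OF \<open>open S\<close> has_derivative]; (rule Ck_on_Suc_has_derivative)?)
      (use Suc in auto)
qed (auto intro: continuous_on)

text \<open>By the Leibniz rule the derivative is a sum of two products, each of one factor with a
  derivative of the other. All four functions involved are C^k, the undifferentiated ones by
  \<open>Ck_on_SucD\<close>.\<close>

lemma (in bounded_bilinear) Ck_on_bounded_bilinear:
  "open S \<Longrightarrow> Ck_on k S f \<Longrightarrow> Ck_on k S g \<Longrightarrow> Ck_on k S (\<lambda>x. prod (f x) (g x))"
proof (induction k arbitrary: f g)
  case (Suc k)
  note D = Ck_on_Suc_has_derivative[OF Suc.prems(2)] Ck_on_Suc_has_derivative[OF Suc.prems(3)]
  show ?case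
    by (rule Ck_on_SucI[OF \<open>open S\<close> FDERIV[OF D]])
      (use Suc Ck_on_SucD[OF Suc.prems(2)] Ck_on_SucD[OF Suc.prems(3)] in
        \<open>auto intro!: Ck_on_add Suc.IH\<close>)
qed (auto intro: continuous_on)

text \<open>The set \<open>C\<close> may contain 0, whose coefficient is then 0 by \<open>x / 0 = 0\<close>.\<close>

lemma orthogonal_spanning_set_expansion:
  fixes B :: "'a::real_inner set"
  assumes "finite B" "span B = UNIV"
  obtains C :: "'a set" where "finite C" "\<And>w. w = (\<Sum>b\<in>C. (w \<bullet> b / (b \<bullet> b)) *\<^sub>R b)"
proof -
  obtain C :: "'a set" where C: "finite C" "span C = UNIV" "pairwise orthogonal C"
    using basis_orthogonal[OF assms(1)] assms(2) by auto
  define P where "P w = (\<Sum>b\<in>C. (w \<bullet> b / (b \<bullet> b)) *\<^sub>R b)" for w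
  \<comment> \<open>\<open>P\<close> is linear and fixes each element of \<open>C\<close> by
    orthogonality, hence is the identity on the span of \<open>C\<close>.\<close>
  have "P w = w" for w
  proof -
    have "linear P"
      unfolding P_def
      by (intro linear_compose_sum ballI linearI)
        (simp_all add: inner_add_left add_divide_distrib scaleR_add_left)
    moreover have "P c = c" if "c \<in> C" for c
    proof -
      have "P c = (\<Sum>b\<in>C. if b = c then c else 0)"
        unfolding P_def
        by (rule sum.cong) (use C(3) that in \<open>auto simp: pairwise_def orthogonal_def\<close>)
      then show ?thesis using C(1) that by simp
    qed
    ultimately show ?thesis
      using linear_eq_on_span[of P "\<lambda>x. x" C w] C(2) linear_id by (auto simp: id_def)
  qed
  then show ?thesis
    using that C(1) unfolding P_def by metis
qed

text \<open>Expanding \<open>Df(x) v\<close> in an orthogonal basis turns \<open>D(g \<circ> f)(x) v = Dg(f x)(Df(x) v)\<close> into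
  a finite sum of products of a component of \<open>Df(x) v\<close> with \<open>Dg(f x) b\<close>, \<open>b\<close> fixed, to which the
  induction hypothesis applies.\<close>

lemma Ck_on_compose:
  fixes f :: "'a::real_normed_vector \<Rightarrow> 'b::real_inner" and B :: "'b set"
  assumes B: "finite B" "span B = UNIV" and S: "open S" "f ` S \<subseteq> T"
    and "Ck_on k S f" "Ck_on k T g"
  shows "Ck_on k S (\<lambda>x. g (f x))"
proof -
  obtain C where C: "finite C" "\<And>w. w = (\<Sum>b\<in>C. (w \<bullet> b / (b \<bullet> b)) *\<^sub>R (b :: 'b))"
    using orthogonal_spanning_set_expansion[OF B] by blast
  show ?thesis
    using assms(5,6)
  proof (induction k arbitrary: g)
    case 0
    then show ?case using S(2) by (auto intro: continuous_on_compose2)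
  next
    case (Suc k)
    define f' where "f' x = frechet_derivative f (at x)" for x
    define g' where "g' y = frechet_derivative g (at y)" for y
    have f: "(f has_derivative f' x) (at x)" if "x \<in> S" for x
      using Ck_on_Suc_has_derivative Suc.prems(1) that unfolding f'_def by blast
    have g: "(g has_derivative g' (f x)) (at (f x))" if "x \<in> S" for x
      using Ck_on_Suc_has_derivative Suc.prems(2) that S(2) unfolding g'_def by blast
    have "Ck_on k S (\<lambda>x. g' (f x) (f' x v))" for v
    proof (rule Ck_on_cong[OF \<open>open S\<close>])
      show "Ck_on k S (\<lambda>x. \<Sum>b\<in>C. (f' x v \<bullet> b / (b \<bullet> b)) *\<^sub>R g' (f x) b)"
        using Suc.prems Ck_on_SucD[OF Suc.prems(1)] unfolding f'_def g'_def
        by (intro Ck_on_sum bounded_bilinear.Ck_on_bounded_bilinear[OF bounded_bilinear_scaleR]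
            bounded_linear.Ck_on_bounded_linear[OF bounded_linear_divide]
            bounded_linear.Ck_on_bounded_linear[OF bounded_linear_inner_left] Suc.IH S(1)) auto
      fix x assume "x \<in> S"
      then have "linear (g' (f x))" using g has_derivative_linear by blast
      then show "(\<Sum>b\<in>C. (f' x v \<bullet> b / (b \<bullet> b)) *\<^sub>R g' (f x) b) = g' (f x) (f' x v)"
        by (subst C(2)[of "f' x v"]) (simp add: linear_sum linear_scale)
    qed
    then show ?case
      by (intro Ck_on_SucI[OF \<open>open S\<close> has_derivative_compose[OF f g]])
  qed
qed

text \<open>The derivative of the slice in direction \<open>v\<close> is that of \<open>f\<close> in
  direction \<open>(0, v)\<close>, which is again a slice of a C^k function.\<close>

lemma Ck_on_slice:
  assumes "open T" "Pair a ` T \<subseteq> S" "Ck_on k S f"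
  shows "Ck_on k T (\<lambda>x. f (a, x))"
  using assms(3)
proof (induction k arbitrary: f)
  case 0
  then show ?case
    by (simp add: continuous_on_compose2[OF _ continuous_on_Pair[OF continuous_on_const
      continuous_on_id] assms(2)])
next
  case (Suc k)
  have "((\<lambda>x. f (a, x)) has_derivative (\<lambda>v. frechet_derivative f (at (a, x)) (0, v))) (at x)"
    if "x \<in> T" for x
    using that assms(2)
    by (intro has_derivative_compose[OF has_derivative_Pair[OF has_derivative_const
        has_derivative_ident]] Ck_on_Suc_has_derivative[OF Suc.prems]) auto
  then show ?case
    by (rule Ck_on_SucI[OF \<open>open T\<close>]) (use Suc in auto)
qed


section \<open>Smooth maps and smooth functions on manifolds\<close>

lemma
  assumes "smooth_manifold M" "(U, c) \<in> atlas M"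
  shows chart_openin: "openin (mtop M) U"
    and chart_inj_on: "inj_on c U"
    and open_chart_image: "\<And>V. openin (mtop M) V \<Longrightarrow> V \<subseteq> U \<Longrightarrow> open (c ` V)"
proof -
  have "chart_of (mtop M) (U, c)"
    using assms by (auto simp: smooth_manifold_def)
  then have U: "openin (mtop M) U" "open (c ` U)"
      and h: "homeomorphic_map (subtopology (mtop M) U) (top_of_set (c ` U)) c"
    by (auto simp: chart_of_def)
  show "openin (mtop M) U" by (fact U)
  have "topspace (subtopology (mtop M) U) = U"
    using openin_subset[OF U(1)] by auto
  then show "inj_on c U"
    using h by (metis homeomorphic_imp_injective_map)
  fix V assume V: "openin (mtop M) V" "V \<subseteq> U"
  then have "openin (subtopology (mtop M) U) V"
    using U(1) openin_open_subtopology by blast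
  then have "openin (top_of_set (c ` U)) (c ` V)"
    using h homeomorphic_imp_open_map open_map_def by blast
  then show "open (c ` V)"
    using U(2) openin_open_trans by blast
qed

lemma open_chart_domain_image:
  "smooth_manifold M \<Longrightarrow> (U, c) \<in> atlas M \<Longrightarrow> open (c ` U)"
  by (rule open_chart_image[OF _ _ chart_openin order_refl])

lemma exists_chart:
  assumes "smooth_manifold M" "p \<in> points M"
  obtains U c where "(U, c) \<in> atlas M" "p \<in> U"
  using assms unfolding smooth_manifold_def by blast

lemma smooth_functionsD:
  "h \<in> smooth_functions M \<Longrightarrow> (U, c) \<in> atlas M \<Longrightarrow> Ck_on k (c ` U) (h \<circ> inv_into U c)"
  by (auto simp: smooth_functions_def smooth_on_def)

lemma smooth_functions_outside: "h \<in> smooth_functions M \<Longrightarrow> p \<notin> points M \<Longrightarrow> h p = 0"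
  by (auto simp: smooth_functions_def)

lemma smooth_functionsI:
  assumes "\<And>U c k. (U, c) \<in> atlas M \<Longrightarrow> Ck_on k (c ` U) (\<lambda>y. h (inv_into U c y))"
    and "\<And>p. p \<notin> points M \<Longrightarrow> h p = 0"
  shows "h \<in> smooth_functions M"
  using assms by (auto simp: smooth_functions_def smooth_on_def comp_def)

lemma smooth_functions_zero: "smooth_manifold M \<Longrightarrow> (\<lambda>x. 0) \<in> smooth_functions M"
  by (rule smooth_functionsI, rule Ck_on_const[OF open_chart_domain_image]) simp_all

lemma
  assumes M: "smooth_manifold M" and h: "h \<in> smooth_functions M"
  shows smooth_functions_add: "k \<in> smooth_functions M \<Longrightarrow> (\<lambda>x. h x + k x) \<in> smooth_functions M"
    and smooth_functions_mult: "k \<in> smooth_functions M \<Longrightarrow> (\<lambda>x. h x * k x) \<in> smooth_functions M"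
    and smooth_functions_scale: "(\<lambda>x. a * h x) \<in> smooth_functions M"
proof -
  note S = open_chart_domain_image[OF M]
  note C = smooth_functionsD[unfolded comp_def]
  note out = smooth_functions_outside
  show "(\<lambda>x. h x + k x) \<in> smooth_functions M" if k: "k \<in> smooth_functions M"
    by (rule smooth_functionsI, rule Ck_on_add[OF S C[OF h] C[OF k]])
      (simp_all add: out[OF h] out[OF k])
  show "(\<lambda>x. h x * k x) \<in> smooth_functions M" if k: "k \<in> smooth_functions M"
    by (rule smooth_functionsI,
        rule bounded_bilinear.Ck_on_bounded_bilinear[OF bounded_bilinear_mult S C[OF h] C[OF k]])
      (simp_all add: out[OF h])
  show "(\<lambda>x. a * h x) \<in> smooth_functions M"
    by (rule smooth_functionsI,
        rule bounded_linear.Ck_on_bounded_linear[OF bounded_linear_mult_right S C[OF h]])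
      (simp_all add: out[OF h])
qed

text \<open>The cut-off to 0 matches the normalisation of \<open>smooth_functions\<close> and the
  formula inside \<open>differential\<close>, so that the differential is the transpose of the
  pullback.\<close>

definition pullback ::
    "('a, 'e::real_inner) manifold \<Rightarrow> ('a \<Rightarrow> 'b) \<Rightarrow> ('b \<Rightarrow> real) \<Rightarrow> 'a \<Rightarrow> real" where
  "pullback M F h = (\<lambda>x. if x \<in> points M then h (F x) else 0)"

lemma openin_chart_preimage:
  assumes "smooth_manifold M" "smooth_manifold N" "continuous_map (mtop M) (mtop N) F"
    and "(U, c) \<in> atlas M" "(V, d) \<in> atlas N"
  shows "openin (mtop M) (U \<inter> F -` V)"
proof -
  have U: "openin (mtop M) U" by (rule chart_openin[OF assms(1,4)])
  moreover have "openin (mtop M) {x \<in> points M. F x \<in> V}"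
    by (rule openin_continuous_map_preimage[OF assms(3) chart_openin[OF assms(2,5)]])
  moreover have "U \<inter> F -` V = U \<inter> {x \<in> points M. F x \<in> V}"
    using openin_subset[OF U] by auto
  ultimately show ?thesis by auto
qed

text \<open>Near a point \<open>p\<close>, in charts \<open>c\<close> at \<open>p\<close> and
  \<open>d\<close> at \<open>F p\<close>, the pullback is the composite of \<open>h\<close> read in
  \<open>d\<close> with \<open>F\<close> read in \<open>c\<close> and \<open>d\<close>. Smoothness
  being local, the chart \<open>d\<close> may depend on \<open>p\<close>.\<close>

lemma pullback_smooth:
  assumes M: "smooth_manifold M" and N: "smooth_manifold N"
    and F: "smooth_map M N F" and h: "h \<in> smooth_functions N"
  shows "pullback M F h \<in> smooth_functions M"
proof (rule smooth_functionsI)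
  fix U c k assume U: "(U, c) \<in> atlas M"
  have cont: "continuous_map (mtop M) (mtop N) F"
    using F by (simp add: smooth_map_def)
  have UM: "U \<subseteq> points M"
    using chart_openin[OF M U] openin_subset by blast
  show "Ck_on k (c ` U) (\<lambda>y. pullback M F h (inv_into U c y))"
  proof (rule Ck_on_local)
    fix y assume "y \<in> c ` U"
    then obtain p where p: "p \<in> U" "y = c p" by auto
    then have "F p \<in> points N"
      using UM cont by (auto simp: continuous_map_def)
    then obtain V d where V: "(V, d) \<in> atlas N" "F p \<in> V"
      using exists_chart[OF N] by metis
    let ?S = "c ` (U \<inter> F -` V)"
    let ?F = "\<lambda>y. d (F (inv_into U c y))"
    have S: "open ?S"
      by (rule open_chart_image[OF M U openin_chart_preimage[OF M N cont U V(1)]]) auto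
    have cF: "Ck_on k ?S ?F"
      using F U V(1) unfolding smooth_map_def smooth_on_def comp_def by fast
    \<comment> \<open>The chain rule expands derivatives in the intermediate space, here the model
      space of \<open>N\<close>.\<close>
    obtain B :: "'d set" where B: "finite B" "span B = UNIV"
      using N by (auto simp: smooth_manifold_def)
    note inv = inv_into_f_f[OF chart_inj_on[OF M U]] inv_into_f_f[OF chart_inj_on[OF N V(1)]]
    have "Ck_on k ?S (\<lambda>y. (h \<circ> inv_into V d) (?F y))"
      by (rule Ck_on_compose[OF B S _ cF smooth_functionsD[OF h V(1)]]) (auto simp: inv)
    then have "Ck_on k ?S (\<lambda>y. pullback M F h (inv_into U c y))"
      by (rule Ck_on_cong[OF S, rotated]) (use UM in \<open>auto simp: inv pullback_def\<close>)
    then show "\<exists>T. open T \<and> y \<in> T \<and> Ck_on k T (\<lambda>y. pullback M F h (inv_into U c y))"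
      using S p V(2) by blast
  qed
qed (simp add: pullback_def)

text \<open>With a chart \<open>e\<close> of \<open>L\<close> around \<open>a\<close>, the chart
  expression of \<open>F a\<close> is that of the two-variable map with the first coordinate frozen
  at \<open>e a\<close>.\<close>

lemma smooth_map_slice:
  assumes L: "smooth_manifold L" and M: "smooth_manifold M" and N: "smooth_manifold N"
    and F: "smooth_map (product_manifold L M) N (\<lambda>(x, y). F x y)" and a: "a \<in> points L"
  shows "smooth_map M N (F a)"
proof -
  have "continuous_map (prod_topology (mtop L) (mtop M)) (mtop N) (\<lambda>(x, y). F x y)"
    using F by (simp add: smooth_map_def product_manifold_def)
  moreover have "continuous_map (mtop M) (prod_topology (mtop L) (mtop M)) (\<lambda>y. (a, y))"
    using a by (simp add: continuous_map_pairedI)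
  ultimately have cont: "continuous_map (mtop M) (mtop N) (F a)"
    using continuous_map_compose[of _ _ "\<lambda>y. (a, y)"] by (fastforce simp: comp_def)
  moreover have "smooth_on (c ` (U \<inter> F a -` V)) (d \<circ> F a \<circ> inv_into U c)"
    if U: "(U, c) \<in> atlas M" and V: "(V, d) \<in> atlas N" for U c V d
  proof -
    obtain W e where W: "(W, e) \<in> atlas L" "a \<in> W"
      using exists_chart[OF L a] by metis
    let ?c = "map_prod e c"
    let ?F = "\<lambda>(x, y). F x y"
    let ?S = "c ` (U \<inter> F a -` V)"
    have "(W \<times> U, ?c) \<in> atlas (product_manifold L M)"
      using W(1) U by (auto simp: product_manifold_def)
    then have *: "Ck_on k (?c ` (W \<times> U \<inter> ?F -` V)) (\<lambda>z. d (?F (inv_into (W \<times> U) ?c z)))" for k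
      using F V unfolding smooth_map_def smooth_on_def comp_def by fast
    have S: "open ?S"
      by (rule open_chart_image[OF M U openin_chart_preimage[OF M N cont U V]]) auto
    have "inj_on ?c (W \<times> U)"
      using map_prod_inj_on chart_inj_on[OF L W(1)] chart_inj_on[OF M U] by blast
    then have inv: "inv_into (W \<times> U) ?c (e a, c y) = (a, y)" if "y \<in> U" for y
      using inv_into_f_f[of ?c "W \<times> U" "(a, y)"] that W(2) by simp
    have "Ck_on k ?S (\<lambda>z. d (?F (inv_into (W \<times> U) ?c (e a, z))))" for k
      by (rule Ck_on_slice[OF S _ *]) (use W(2) in \<open>force\<close>)
    then have "Ck_on k ?S (d \<circ> F a \<circ> inv_into U c)" for k
      by (rule Ck_on_cong[OF S, rotated])
        (use inv_into_f_f[OF chart_inj_on[OF M U]] in \<open>auto simp: inv\<close>)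
    then show ?thesis by (simp add: smooth_on_def)
  qed
  ultimately show ?thesis
    by (auto simp: smooth_map_def)
qed


section \<open>Pushforward of vector fields\<close>

lemma differential_eq:
  "differential M N F p v h = (if h \<in> smooth_functions N then v (pullback M F h) else 0)"
  by (simp add: differential_def pullback_def)

text \<open>Pullback respects sums, products and scalar multiples, and its value at \<open>p\<close>
  is the value of \<open>h\<close> at \<open>F p\<close>. Hence a derivation at \<open>p\<close>
  composed with it is a derivation at \<open>F p\<close>.\<close>

lemma differential_in_tangent_space:
  assumes M: "smooth_manifold M" and N: "smooth_manifold N" and F: "smooth_map M N F"
    and p: "p \<in> points M" and v: "v \<in> tangent_space M p"
  shows "differential M N F p v \<in> tangent_space N (F p)"
proof -
  have add: "pullback M F (\<lambda>x. h x + k x) = (\<lambda>x. pullback M F h x + pullback M F k x)"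
    and mult: "pullback M F (\<lambda>x. h x * k x) = (\<lambda>x. pullback M F h x * pullback M F k x)"
    and scale: "pullback M F (\<lambda>x. a * h x) = (\<lambda>x. a * pullback M F h x)"
    and at_p: "pullback M F h p = h (F p)" for h k :: "'c \<Rightarrow> real" and a
    using p by (auto simp: pullback_def)
  note smooth = pullback_smooth[OF M N F]
  let ?D = "differential M N F p v"
  have "?D (\<lambda>x. h x + k x) = ?D h + ?D k"
    "?D (\<lambda>x. h x * k x) = h (F p) * ?D k + k (F p) * ?D h"
    if "h \<in> smooth_functions N" "k \<in> smooth_functions N" for h k
    using v that smooth[OF that(1)] smooth[OF that(2)]
    by (simp_all add: tangent_space_def differential_eq add mult at_p
        smooth_functions_add[OF N] smooth_functions_mult[OF N])
  moreover have "?D (\<lambda>x. a * h x) = a * ?D h" if "h \<in> smooth_functions N" for a h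
    using v that smooth[OF that]
    by (simp add: tangent_space_def differential_eq scale smooth_functions_scale[OF N])
  ultimately show ?thesis
    unfolding tangent_space_def by (simp add: differential_eq)
qed

lemma subspace_vector_fields:
  assumes M: "smooth_manifold M"
  shows "subspace (vector_fields M)"
proof (rule subspaceI)
  show "0 \<in> vector_fields M"
    using smooth_functions_zero[OF M] by (auto simp: vector_fields_def tangent_space_def)
next
  fix g k assume "g \<in> vector_fields M" "k \<in> vector_fields M"
  then show "g + k \<in> vector_fields M"
    using smooth_functions_add[OF M]
    by (auto simp: vector_fields_def tangent_space_def algebra_simps)
next
  fix a g assume "g \<in> vector_fields M"
  then show "a *\<^sub>R g \<in> vector_fields M"
    using smooth_functions_scale[OF M]
    by (auto simp: vector_fields_def tangent_space_def scaleR_fun_def algebra_simps zero_fun_def)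
qed

text \<open>At each point and test function the pushforward either evaluates the field at a fixed
  point and a fixed function or returns 0; both are linear in the field.\<close>

lemma linear_pushforward: "linear (pushforward M F)"
  by (rule linearI)
    (auto simp: pushforward_def differential_def scaleR_fun_def fun_eq_iff)

text \<open>Smoothness comes from two pullbacks: applying the pushed field to \<open>h\<close> means
  pulling \<open>h\<close> back along \<open>F\<close>, applying \<open>g\<close>, and pulling the
  result back along the inverse \<open>E\<close>.\<close>

lemma pushforward_in_vector_fields:
  assumes M: "smooth_manifold M" and F: "smooth_map M M F" and E: "smooth_map M M E"
    and EF: "\<And>p. p \<in> points M \<Longrightarrow> E (F p) = p" "\<And>p. p \<in> points M \<Longrightarrow> F (E p) = p"
    and g: "g \<in> vector_fields M"
  shows "pushforward M F g \<in> vector_fields M"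
proof -
  have E_pts: "E p \<in> points M" if "p \<in> points M" for p
    using E that by (auto simp: smooth_map_def continuous_map_def)
  have inv: "inv_into (points M) F p = E p" if "p \<in> points M" for p
    using that EF E_pts by (metis inj_on_inverseI inv_into_f_f)
  have "pushforward M F g p \<in> tangent_space M p" if "p \<in> points M" for p
    using differential_in_tangent_space[OF M M F E_pts[OF that], of "g (E p)"] g E_pts that EF(2)
    by (auto simp: pushforward_def inv vector_fields_def)
  moreover have "(\<lambda>p. pushforward M F g p h) \<in> smooth_functions M"
    if h: "h \<in> smooth_functions M" for h
  proof -
    have "(\<lambda>q. g q (pullback M F h)) \<in> smooth_functions M"
      using g pullback_smooth[OF M M F h] by (auto simp: vector_fields_def)
    then have "pullback M E (\<lambda>q. g q (pullback M F h)) \<in> smooth_functions M"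
      by (rule pullback_smooth[OF M M E])
    moreover have "pullback M E (\<lambda>q. g q (pullback M F h)) = (\<lambda>p. pushforward M F g p h)"
      using h by (auto simp: pushforward_def differential_eq pullback_def[of M E] inv)
    ultimately show ?thesis by simp
  qed
  ultimately show ?thesis
    by (auto simp: vector_fields_def pushforward_def)
qed

section \<open>The action of the group on vector fields by pushforward\<close>

locale smooth_right_action =
  fixes G :: "'g monoid" (structure)
    and L :: "('g, 'l::real_inner) manifold"
    and M :: "('m, 'e::real_inner) manifold"
    and \<phi> :: "'g \<Rightarrow> 'm \<Rightarrow> 'm"
  assumes M: "smooth_manifold M"
    and L: "lie_group G L"
    and act: "right_action G (points M) \<phi>"
    and smooth: "smooth_map (product_manifold L M) M (\<lambda>(X, \<xi>). \<phi> X \<xi>)"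
begin

sublocale group G
  using L by (simp add: lie_group_def)

lemma act_closed: "X \<in> carrier G \<Longrightarrow> p \<in> points M \<Longrightarrow> \<phi> X p \<in> points M"
  and act_one: "p \<in> points M \<Longrightarrow> \<phi> \<one> p = p"
  and act_mult: "X \<in> carrier G \<Longrightarrow> Y \<in> carrier G \<Longrightarrow> p \<in> points M \<Longrightarrow>
    \<phi> Y (\<phi> X p) = \<phi> (X \<otimes> Y) p"
  using act by (auto simp: right_action_def)

lemma act_inv:
  assumes "X \<in> carrier G" "p \<in> points M"
  shows "\<phi> (inv X) (\<phi> X p) = p" "\<phi> X (\<phi> (inv X) p) = p"
  using assms by (simp_all add: act_mult act_one)

lemma inv_into_act:
  assumes "X \<in> carrier G" "p \<in> points M"
  shows "inv_into (points M) (\<phi> X) p = \<phi> (inv X) p"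
  using assms act_inv act_closed by (metis inj_on_inverseI inv_closed inv_into_f_f)

lemma smooth_map_act: "X \<in> carrier G \<Longrightarrow> smooth_map M M (\<phi> X)"
  using smooth_map_slice[OF _ M M smooth] L by (simp add: lie_group_def)

lemma pushforward_act_in_vector_fields:
  assumes "X \<in> carrier G" "g \<in> vector_fields M"
  shows "pushforward M (\<phi> X) g \<in> vector_fields M"
  using assms
  by (intro pushforward_in_vector_fields[where E = "\<phi> (inv X)"] M smooth_map_act act_inv inv_closed)

text \<open>This is the source of equivariance: at the point \<open>\<phi> X p\<close> the inverse
  in the definition of the pushforward cancels.\<close>

lemma pushforward_act_apply:
  assumes "X \<in> carrier G" "p \<in> points M"
  shows "pushforward M (\<phi> X) g (\<phi> X p) = differential M M (\<phi> X) p (g p)"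
  using assms by (simp add: pushforward_def inv_into_act act_closed act_inv)

text \<open>The normalisations matter here: a smooth \<open>h\<close> equals its pullback also off
  \<open>points M\<close>, where both are 0, and \<open>g p\<close> vanishes on non-smooth
  functions.\<close>

lemma pushforward_act_one:
  assumes g: "g \<in> vector_fields M"
  shows "pushforward M (\<phi> \<one>) g = g"
proof (intro ext)
  fix p h
  have "pullback M (\<phi> \<one>) h = h" if "h \<in> smooth_functions M"
    using smooth_functions_outside[OF that] by (auto simp: pullback_def act_one)
  then show "pushforward M (\<phi> \<one>) g p h = g p h"
    using g
    by (auto simp: pushforward_def inv_into_act act_one differential_eq vector_fields_def
        tangent_space_def)
qed

text \<open>Pullbacks compose in reverse order, and so do inverses: applying inv Y and then inv X
  acts as the inverse of \<open>X \<otimes> Y\<close>, so the base points agree.\<close>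

lemma pushforward_act_mult:
  assumes XY: "X \<in> carrier G" "Y \<in> carrier G"
  shows "pushforward M (\<phi> Y) (pushforward M (\<phi> X) g) = pushforward M (\<phi> (X \<otimes> Y)) g"
proof (intro ext)
  fix p h
  have "pullback M (\<phi> X) (pullback M (\<phi> Y) h) = pullback M (\<phi> (X \<otimes> Y)) h"
    using XY by (auto simp: pullback_def act_mult act_closed)
  then show "pushforward M (\<phi> Y) (pushforward M (\<phi> X) g) p h = pushforward M (\<phi> (X \<otimes> Y)) g p h"
    \<comment> \<open>The inner differential returns 0 on non-smooth functions, so the pullback of
      \<open>h\<close> along \<open>\<phi> Y\<close> has to be smooth.\<close>
    using XY pullback_smooth[OF M M smooth_map_act[OF XY(2)]]
    by (auto simp: pushforward_def inv_into_act act_closed act_mult inv_mult_group differential_eq)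
qed

lemma extended_velocity_space_vector_fields:
  assumes "\<And>v. f v \<in> vector_fields M"
  shows "extended_velocity_space G M \<phi> f \<subseteq> vector_fields M"
  unfolding extended_velocity_space_def
  by (rule span_minimal[OF _ subspace_vector_fields[OF M]])
    (use assms pushforward_act_in_vector_fields in auto)

text \<open>Pushing the generator given by \<open>Y\<close> and \<open>v\<close> forward along
  \<open>\<phi> X\<close> yields the generator given by \<open>Y \<otimes> X\<close> and
  \<open>v\<close>; linearity extends this from generators to the span.\<close>

lemma pushforward_extended_velocity_space:
  assumes X: "X \<in> carrier G" and w: "w \<in> extended_velocity_space G M \<phi> f"
  shows "pushforward M (\<phi> X) w \<in> extended_velocity_space G M \<phi> f"
proof -
  let ?A = "{pushforward M (\<phi> X) (f v) | X v. X \<in> carrier G}"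
  have "pushforward M (\<phi> X) ` ?A \<subseteq> ?A"
    using X by (auto simp: pushforward_act_mult) (metis m_closed)
  then have "span (pushforward M (\<phi> X) ` ?A) \<subseteq> span ?A"
    by (rule span_mono)
  then show ?thesis
    using w unfolding extended_velocity_space_def linear_span_image[OF linear_pushforward] by blast
qed

end

theorem proposition4p1:
  fixes M :: "('m, 'e::real_inner) manifold"
    and G :: "'g monoid"
    and L :: "('g, 'l::real_inner) manifold"
    and \<phi> :: "'g \<Rightarrow> 'm \<Rightarrow> 'm"
    and f :: "'v::real_vector \<Rightarrow> 'm \<Rightarrow> 'm tangent"
  assumes "smooth_manifold M"
    and "lie_group G L"
    and "smooth_transitive_right_action G L M \<phi>"
    and "kinematic_system M UNIV f"
    and "{v. f v = 0} = {0}"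
  shows "kinematic_system M (extended_velocity_space G M \<phi> f) extended_system \<and>
    right_action G (extended_velocity_space G M \<phi> f) (extended_action M \<phi>) \<and>
    equivariant_wrt G M \<phi> (extended_velocity_space G M \<phi> f) extended_system (extended_action M \<phi>)"
proof -
  interpret smooth_right_action G L M \<phi>
    using assms(1-3) by unfold_locales (auto simp: smooth_transitive_right_action_def)
  \<comment> \<open>Besides making the inclusion a kinematic system, this is what the identity law
    requires, since \<open>pushforward_act_one\<close> holds for vector fields.\<close>
  have V: "extended_velocity_space G M \<phi> f \<subseteq> vector_fields M"
    using assms(4) by (intro extended_velocity_space_vector_fields) (auto simp: kinematic_system_def)
  have "kinematic_system M (extended_velocity_space G M \<phi> f) extended_system"
    using V by (auto simp: kinematic_system_def extended_system_def extended_velocity_space_def)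
  moreover have "right_action G (extended_velocity_space G M \<phi> f) (extended_action M \<phi>)"
    using V pushforward_extended_velocity_space pushforward_act_one pushforward_act_mult
    by (auto simp: right_action_def extended_action_def extended_system_def)
  moreover have
    "equivariant_wrt G M \<phi> (extended_velocity_space G M \<phi> f) extended_system (extended_action M \<phi>)"
    by (simp add: equivariant_wrt_def extended_action_def extended_system_def pushforward_act_apply)
  ultimately show ?thesis by blast
qed

end
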